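(* Let $\mathcal P$ be a reference probability measure over $\{0,1\}^{\mathcal X}$, and let $A$ be a learning rule that is $n$-sample $\rho$-TV indistinguishable and absolutely continuous with respect to $\mathcal P$. Then there exists an equivalent learning rule $A'$ that is $n$-sample $\frac{2\rho}{1+\rho}$-replicable.
   Context: An $n$-sample learning rule over a domain $\mathcal X$ is a randomized map $A:(\mathcal X\times\{0,1\})^n\to\{0,1\}^{\mathcal X}$; $A(S)$ denotes the probability distribution of its output on input $S$. $A$ is $n$-sample $\rho$-TV indistinguishable if for every distribution $\mathcal D$ over $\mathcal X\times\{0,1\}$ and independent $S,S'\sim\mathcal D^n$, $\mathbf E_{S,S'}[d_{\mathrm{TV}}(A(S),A(S'))]\le\rho$. $A$ is absolutely continuous with respect to $\mathcal P$ if for every distribution $\mathcal D$ over inputs, for almost every sample $S$ drawn from $\mathcal D^n$, the distribution $A(S)$ is absolutely continuous with respect to $\mathcal P$. Two learning rules $A,A'$ are equivalent if $A(S)=A'(S)$ (as distributions over hypotheses) for every sample $S$. $A'$ is $n$-sample $\rho'$-replicable if there is a probability space $\mathcal R$ (internal randomness) and an implementation $A'(S,r)$, deterministic in $(S,r)$, with $A'(S)$ the law of $A'(S,r)$ for $r\sim\mathcal R$, such that for every distribution $\mathcal D$ over $\mathcal X\times\{0,1\}$, $\Pr_{S,S'\sim\mathcal D^n,\ r\sim\mathcal R}[A'(S,r)\ne A'(S',r)]\le\rho'$, with $S,S',r$ independent. *)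

theory Defs
  imports "HOL-Probability.Probability"
begin

text \<open>
  The domain is the type \<open>'x\<close> with an arbitrary sigma-algebra \<open>MX\<close>, and hypotheses are functions
  \<open>'x \<Rightarrow> bool\<close> with an arbitrary sigma-algebra \<open>H\<close>.  A randomized rule is represented by the map
  sending a sample to the law of its output; no measurability in the sample is required.

  For an uncountable domain, quantities such as the total variation distance of two outputs as a
  function of the two samples, or the event that two outputs differ, may fail to be measurable.
  Expectations and probabilities are therefore upper ones.  They agree with the usual notions as
  soon as the latter make sense (see the two lemmas below), whereas the Lebesgue integral of the
  library is \<open>0\<close> on non-integrable functions, which would make upper bounds vacuous.
\<close>

definition upper_expectation :: "'a measure \<Rightarrow> ('a \<Rightarrow> real) \<Rightarrow> real" where
  "upper_expectation M f =
    Inf {integral\<^sup>L M g | g. integrable M g \<and> (\<forall>x\<in>space M. f x \<le> g x)}"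

definition upper_prob :: "'a measure \<Rightarrow> ('a \<Rightarrow> bool) \<Rightarrow> real" where
  "upper_prob M Q = upper_expectation M (\<lambda>x. of_bool (Q x))"

lemma upper_expectation_eq_integral:
  assumes "integrable M f"
  shows "upper_expectation M f = integral\<^sup>L M f"
  unfolding upper_expectation_def
proof (rule cInf_eq_minimum)
  show "integral\<^sup>L M f \<in> {integral\<^sup>L M g | g. integrable M g \<and> (\<forall>x\<in>space M. f x \<le> g x)}"
    using assms by auto
next
  fix y
  assume "y \<in> {integral\<^sup>L M g | g. integrable M g \<and> (\<forall>x\<in>space M. f x \<le> g x)}"
  then obtain g where "y = integral\<^sup>L M g" "integrable M g" "\<forall>x\<in>space M. f x \<le> g x"
    by auto
  then show "integral\<^sup>L M f \<le> y"
    using assms by (auto intro!: integral_mono)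
qed

lemma upper_expectation_cong:
  "(\<And>x. x \<in> space M \<Longrightarrow> f x = g x) \<Longrightarrow> upper_expectation M f = upper_expectation M g"
  unfolding upper_expectation_def by (rule arg_cong[where f = Inf]) auto

lemma upper_expectation_upper_prob_eq_joint_prob:
  assumes "prob_space N" "prob_space R"
    and E: "{z \<in> space (N \<Otimes>\<^sub>M R). Q (fst z) (snd z)} \<in> sets (N \<Otimes>\<^sub>M R)"
  shows "upper_expectation N (\<lambda>p. upper_prob R (Q p)) =
    measure (N \<Otimes>\<^sub>M R) {z \<in> space (N \<Otimes>\<^sub>M R). Q (fst z) (snd z)}" (is "_ = measure _ ?E")
proof -
  interpret N: prob_space N by fact
  interpret R: prob_space R by fact
  interpret pair_prob_space N R ..
  have 1: "upper_prob R (Q p) = measure R (Pair p -` ?E)" if "p \<in> space N" for p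
  proof -
    have s: "Pair p -` ?E \<in> sets R" using E by (rule sets_Pair1)
    have "upper_prob R (Q p) = upper_expectation R (indicat_real (Pair p -` ?E))"
      unfolding upper_prob_def using that
      by (intro upper_expectation_cong) (auto simp: indicator_def space_pair_measure)
    also have "\<dots> = measure R (Pair p -` ?E)"
      using s by (subst upper_expectation_eq_integral) (auto simp: R.emeasure_eq_measure)
    finally show ?thesis .
  qed
  have m: "(\<lambda>p. measure R (Pair p -` ?E)) \<in> borel_measurable N"
    using R.measurable_emeasure_Pair[OF E] unfolding measure_def by measurable
  have i: "integrable N (\<lambda>p. measure R (Pair p -` ?E))"
    by (rule N.integrable_const_bound[where B = 1]) (use m in auto)
  have "upper_expectation N (\<lambda>p. upper_prob R (Q p)) = (\<integral>p. measure R (Pair p -` ?E) \<partial>N)"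
    using 1 upper_expectation_eq_integral[OF i] by (simp cong: upper_expectation_cong)
  also have "ennreal \<dots> = ennreal (measure (N \<Otimes>\<^sub>M R) ?E)"
    using R.emeasure_pair_measure_alt[OF E] i
    by (simp add: nn_integral_eq_integral[symmetric] R.emeasure_eq_measure emeasure_eq_measure)
  then have "(\<integral>p. measure R (Pair p -` ?E) \<partial>N) = measure (N \<Otimes>\<^sub>M R) ?E"
    by (subst (asm) ennreal_inj) auto
  finally show ?thesis .
qed

definition tv_dist :: "'a measure \<Rightarrow> 'a measure \<Rightarrow> real" where
  "tv_dist M N = (SUP E\<in>sets M. \<bar>measure M E - measure N E\<bar>)"

definition example_space :: "'x measure \<Rightarrow> ('x \<times> bool) measure" where
  "example_space MX = MX \<Otimes>\<^sub>M count_space UNIV"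

definition sample_space :: "'x measure \<Rightarrow> nat \<Rightarrow> (nat \<Rightarrow> 'x \<times> bool) measure" where
  "sample_space MX n = (\<Pi>\<^sub>M i\<in>{..<n}. example_space MX)"

definition distributions :: "'x measure \<Rightarrow> ('x \<times> bool) measure set" where
  "distributions MX = {D. prob_space D \<and> sets D = sets (example_space MX)}"

definition iid_samples :: "nat \<Rightarrow> ('x \<times> bool) measure \<Rightarrow> (nat \<Rightarrow> 'x \<times> bool) measure" where
  "iid_samples n D = (\<Pi>\<^sub>M i\<in>{..<n}. D)"

type_synonym 'x rule = "(nat \<Rightarrow> 'x \<times> bool) \<Rightarrow> ('x \<Rightarrow> bool) measure"

definition learning_rule ::
  "'x measure \<Rightarrow> ('x \<Rightarrow> bool) measure \<Rightarrow> nat \<Rightarrow> 'x rule \<Rightarrow> bool" where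
  "learning_rule MX H n A \<longleftrightarrow>
    (\<forall>S\<in>space (sample_space MX n). prob_space (A S) \<and> sets (A S) = sets H)"

definition tv_indistinguishable :: "'x measure \<Rightarrow> nat \<Rightarrow> real \<Rightarrow> 'x rule \<Rightarrow> bool" where
  "tv_indistinguishable MX n \<rho> A \<longleftrightarrow>
    (\<forall>D\<in>distributions MX.
      upper_expectation (iid_samples n D \<Otimes>\<^sub>M iid_samples n D)
        (\<lambda>(S, S'). tv_dist (A S) (A S')) \<le> \<rho>)"

definition absolutely_continuous_rule ::
  "'x measure \<Rightarrow> nat \<Rightarrow> ('x \<Rightarrow> bool) measure \<Rightarrow> 'x rule \<Rightarrow> bool" where
  "absolutely_continuous_rule MX n P A \<longleftrightarrow>
    (\<forall>D\<in>distributions MX. AE S in iid_samples n D. absolutely_continuous P (A S))"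

definition equivalent_rules :: "'x measure \<Rightarrow> nat \<Rightarrow> 'x rule \<Rightarrow> 'x rule \<Rightarrow> bool" where
  "equivalent_rules MX n A A' \<longleftrightarrow> (\<forall>S\<in>space (sample_space MX n). A S = A' S)"

definition implements ::
  "'x measure \<Rightarrow> ('x \<Rightarrow> bool) measure \<Rightarrow> nat \<Rightarrow> 'r measure
    \<Rightarrow> ((nat \<Rightarrow> 'x \<times> bool) \<Rightarrow> 'r \<Rightarrow> 'x \<Rightarrow> bool) \<Rightarrow> 'x rule \<Rightarrow> bool" where
  "implements MX H n R F A \<longleftrightarrow>
    (\<forall>S\<in>space (sample_space MX n). F S \<in> R \<rightarrow>\<^sub>M H \<and> distr R H (F S) = A S)"

text \<open>
  The three variables are independent, and the disagreement probability is taken first over the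
  internal randomness and then over the pair of samples.  When the disagreement event is measurable
  in the product of the three spaces, this is its probability there, by
  \<open>upper_expectation_upper_prob_eq_joint_prob\<close>.
\<close>

definition replicable_implementation ::
  "'x measure \<Rightarrow> nat \<Rightarrow> real \<Rightarrow> 'r measure
    \<Rightarrow> ((nat \<Rightarrow> 'x \<times> bool) \<Rightarrow> 'r \<Rightarrow> 'x \<Rightarrow> bool) \<Rightarrow> bool" where
  "replicable_implementation MX n \<rho> R F \<longleftrightarrow>
    (\<forall>D\<in>distributions MX.
      upper_expectation (iid_samples n D \<Otimes>\<^sub>M iid_samples n D)
        (\<lambda>(S, S'). upper_prob R (\<lambda>r. F S r \<noteq> F S' r)) \<le> \<rho>)"

text \<open>
  HOL cannot quantify existentially over the type underlying the probability space of internal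
  randomness, so a type is fixed: sequences of hypotheses, each marked with two real numbers.
  Asking for a probability space on this particular type only makes replicability more demanding.
\<close>

type_synonym 'x seed = "nat \<Rightarrow> ('x \<Rightarrow> bool) \<times> real \<times> real"

definition replicable ::
  "'x measure \<Rightarrow> ('x \<Rightarrow> bool) measure \<Rightarrow> nat \<Rightarrow> real \<Rightarrow> 'x rule \<Rightarrow> bool" where
  "replicable MX H n \<rho> A \<longleftrightarrow>
    (\<exists>(R :: 'x seed measure) F.
      prob_space R \<and> implements MX H n R F A \<and> replicable_implementation MX n \<rho> R F)"

end

theory Submission
  imports Defs "HOL-Real_Asymp.Real_Asymp"
begin

text \<open>
  Every sample has positive outer probability under some distribution, so \<open>A S\<close> has a
  density \<open>f\<^sub>S\<close> with respect to \<open>P\<close> for every \<open>S\<close>. The shared randomness is a Poisson process of points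
  \<open>(h, u, t)\<close> with intensity \<open>P\<close> times Lebesgue measure on \<open>u \<ge> 0\<close>, \<open>t \<ge> 0\<close>, and the rule outputs the \<open>h\<close> of
  the earliest point with \<open>u < f\<^sub>S h\<close>. The earliest point in a region of finite measure is uniformly
  distributed there, so the output has law \<open>A S\<close>. If the earliest point below \<open>max f\<^sub>S f\<^sub>S'\<close> lies below
  \<open>min f\<^sub>S f\<^sub>S'\<close>, both samples give the same output; this has probability
  \<open>\<integral>min / \<integral>max = (1 - d) / (1 + d)\<close> for the total variation distance \<open>d\<close>. The bound \<open>2 d / (1 + d)\<close> on the
  disagreement is concave in \<open>d\<close>, so Jensen's inequality concludes. The process is made of independent
  cells, one per unit interval of heights \<open>u\<close> and of times \<open>t\<close>; only void probabilities are ever needed.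
\<close>

subsection \<open>Poisson processes\<close>

definition unit_uniform :: "real measure" where
  "unit_uniform = uniform_measure lborel {0..<1}"

lemma sets_unit_uniform [measurable_cong]: "sets unit_uniform = sets borel"
  by (simp add: unit_uniform_def)

lemma space_unit_uniform [simp]: "space unit_uniform = UNIV"
  by (simp add: unit_uniform_def)

lemma prob_space_unit_uniform: "prob_space unit_uniform"
  unfolding unit_uniform_def by (rule prob_space_uniform_measure) auto

text \<open>\<open>clip (x - real k)\<close> is the length of the part of \<open>[0, x)\<close>
  inside \<open>[k, k + 1)\<close>: it distributes a height or a time over unit cells.\<close>

definition clip :: "real \<Rightarrow> real" where
  "clip x = max 0 (min 1 x)"

lemma clip_bounds [simp]: "0 \<le> clip x" "clip x \<le> 1"
  by (auto simp: clip_def)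

lemma borel_measurable_clip [measurable]: "clip \<in> borel_measurable borel"
  unfolding clip_def by measurable

lemma sum_clip:
  assumes "0 \<le> x"
  shows "(\<Sum>k<n. clip (x - real k)) = min x (real n)"
  using assms by (induction n) (auto simp: clip_def min_def max_def)

lemma clip_sums:
  assumes "0 \<le> x"
  shows "(\<lambda>k. clip (x - real k)) sums x"
proof -
  obtain N where N: "x \<le> real N"
    using real_arch_simple by blast
  then have "\<forall>\<^sub>F n in sequentially. (\<Sum>k<n. clip (x - real k)) = x"
    using assms by (auto simp: sum_clip intro!: eventually_sequentiallyI[of N])
  then show ?thesis
    unfolding sums_def by (rule tendsto_eventually)
qed

lemma measure_unit_uniform_less: "measure unit_uniform {t. 0 \<le> t \<and> t < x} = clip x"
proof -
  have "{0..<1} \<inter> {t. 0 \<le> t \<and> t < x} = {0..<clip x}"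
    by (auto simp: clip_def)
  then have "emeasure unit_uniform {t. 0 \<le> t \<and> t < x} = ennreal (clip x) / 1"
    unfolding unit_uniform_def by (subst emeasure_uniform_measure) simp_all
  also have "\<dots> = ennreal (clip x)"
    by (simp add: divide_ennreal_def)
  finally show ?thesis
    by (simp add: measure_eq_emeasure_eq_ennreal)
qed

type_synonym 'a configuration = "nat \<times> nat \<Rightarrow> nat \<times> (nat \<Rightarrow> 'a \<times> real)"

text \<open>In \<open>\<omega> (k, m) = (N, z)\<close>, the cell of level \<open>k\<close> and time slot \<open>[m, m + 1)\<close>, only the points
  \<open>z j\<close> with \<open>j < N\<close> exist; the number \<open>N\<close> is Poisson, so that disjoint regions of a cell are
  independent, and the real component of \<open>z j\<close> is the arrival time relative to \<open>m\<close>.\<close>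

definition poisson_cell :: "'a measure \<Rightarrow> (nat \<times> (nat \<Rightarrow> 'a \<times> real)) measure" where
  "poisson_cell Q = measure_pmf (poisson_pmf 1) \<Otimes>\<^sub>M (\<Pi>\<^sub>M j\<in>UNIV. Q \<Otimes>\<^sub>M unit_uniform)"

definition poisson_space :: "'a measure \<Rightarrow> 'a configuration measure" where
  "poisson_space Q = (\<Pi>\<^sub>M c\<in>UNIV. poisson_cell Q)"

section \<open>Points of a configuration and their order of arrival\<close>

definition point :: "'a configuration \<Rightarrow> nat \<times> nat \<times> nat \<Rightarrow> 'a" where
  "point \<omega> = (\<lambda>(k, m, j). fst (snd (\<omega> (k, m)) j))"

text \<open>\<open>unit_uniform\<close> charges only \<open>[0, 1)\<close>, but its space is the
  whole line. The sign condition makes the points of slot \<open>m\<close> arrive no earlier than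
  \<open>m\<close> surely, so that finitely many slots matter before a given time.\<close>

definition active :: "'a configuration \<Rightarrow> nat \<times> nat \<times> nat \<Rightarrow> bool" where
  "active \<omega> = (\<lambda>(k, m, j). j < fst (\<omega> (k, m)) \<and> 0 \<le> snd (snd (\<omega> (k, m)) j))"

definition arrival :: "'a configuration \<Rightarrow> nat \<times> nat \<times> nat \<Rightarrow> real" where
  "arrival \<omega> = (\<lambda>(k, m, j). real m + snd (snd (\<omega> (k, m)) j))"

text \<open>A region is one set of marks per level. Later a mark is a hypothesis with its height
  above level \<open>k\<close>, and \<open>W\<close> cuts a region of hypotheses and heights into
  unit layers.\<close>

definition hits ::
  "(nat \<Rightarrow> 'a set) \<Rightarrow> 'a configuration \<Rightarrow> nat \<times> nat \<times> nat \<Rightarrow> bool" where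
  "hits W \<omega> i \<longleftrightarrow> active \<omega> i \<and> point \<omega> i \<in> W (fst i)"

text \<open>Ties are broken by index, which makes the earliest hit unique surely and not only almost surely.\<close>

definition precedes ::
  "'a configuration \<Rightarrow> nat \<times> nat \<times> nat \<Rightarrow> nat \<times> nat \<times> nat \<Rightarrow> bool" where
  "precedes \<omega> i i' \<longleftrightarrow>
    arrival \<omega> i < arrival \<omega> i' \<or> arrival \<omega> i \<le> arrival \<omega> i' \<and> to_nat i \<le> to_nat i'"

definition first_hit ::
  "(nat \<Rightarrow> 'a set) \<Rightarrow> 'a configuration \<Rightarrow> nat \<times> nat \<times> nat \<Rightarrow> bool" where
  "first_hit W \<omega> i \<longleftrightarrow> hits W \<omega> i \<and> (\<forall>i'. hits W \<omega> i' \<longrightarrow> precedes \<omega> i i')"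

lemma precedes_antisym: "precedes \<omega> i i' \<Longrightarrow> precedes \<omega> i' i \<Longrightarrow> i = i'"
  unfolding precedes_def by (rule injD[OF inj_to_nat]) linarith

lemma first_hit_unique: "first_hit W \<omega> i \<Longrightarrow> first_hit W \<omega> i' \<Longrightarrow> i = i'"
  unfolding first_hit_def by (blast intro: precedes_antisym)

lemma hits_mono: "hits V \<omega> i \<Longrightarrow> (\<And>k. V k \<subseteq> W k) \<Longrightarrow> hits W \<omega> i"
  unfolding hits_def by auto

text \<open>The earliest hit of a larger region stays earliest among fewer competitors. This is how
  two samples come to choose the same point.\<close>

lemma first_hit_subset:
  assumes "first_hit W \<omega> i" "point \<omega> i \<in> V (fst i)" "\<And>k. V k \<subseteq> W k"
  shows "first_hit V \<omega> i"
  using assms hits_mono[of V \<omega> _ W] unfolding first_hit_def by (auto simp: hits_def)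

lemma precedes_linear: "precedes \<omega> i i' \<or> precedes \<omega> i' i"
  unfolding precedes_def by linarith

lemma precedes_trans: "precedes \<omega> i i' \<Longrightarrow> precedes \<omega> i' i'' \<Longrightarrow> precedes \<omega> i i''"
  unfolding precedes_def by linarith

lemma finite_first:
  assumes "finite I" "I \<noteq> {}"
  shows "\<exists>i\<in>I. \<forall>i'\<in>I. precedes \<omega> i i'"
  using assms
proof (induction I rule: finite_ne_induct)
  case (singleton a)
  show ?case using precedes_linear[of \<omega> a a] by blast
next
  case (insert a I)
  then obtain i where i: "i \<in> I" "\<forall>i'\<in>I. precedes \<omega> i i'"
    by blast
  show ?case
  proof (cases "precedes \<omega> a i")
    case True
    then have "\<forall>i'\<in>insert a I. precedes \<omega> a i'"
      using i precedes_linear[of \<omega> a a] precedes_trans[of \<omega> a i] by blast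
    then show ?thesis by blast
  next
    case False
    then have "precedes \<omega> i a"
      using precedes_linear by blast
    then show ?thesis using i by blast
  qed
qed

text \<open>Infinitely many levels may contribute points before time \<open>T\<close>, and then no
  earliest one need exist. The bound \<open>K\<close> leaves finitely many cells, each with finitely
  many points.\<close>

lemma ex_first_hit:
  assumes hit: "hits W \<omega> i\<^sub>0" "arrival \<omega> i\<^sub>0 < T"
    and low: "\<And>i. hits W \<omega> i \<Longrightarrow> arrival \<omega> i < T \<Longrightarrow> fst i < K"
  shows "\<exists>i. first_hit W \<omega> i \<and> arrival \<omega> i < T"
proof -
  define I where "I = {i. hits W \<omega> i \<and> arrival \<omega> i < T}"
  obtain n where n: "T \<le> real n"
    using real_arch_simple by blast
  have "I \<subseteq> (\<Union>k<K. \<Union>m<n. (\<lambda>j. (k, m, j)) ` {..<fst (\<omega> (k, m))})"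
  proof
    fix i assume i: "i \<in> I"
    obtain k m j where [simp]: "i = (k, m, j)" by (cases i) auto
    have "k < K" using low[of i] i by (simp add: I_def)
    moreover have "j < fst (\<omega> (k, m))" "0 \<le> snd (snd (\<omega> (k, m)) j)"
      "real m + snd (snd (\<omega> (k, m)) j) < T"
      using i by (simp_all add: I_def hits_def active_def arrival_def)
    moreover from this have "m < n" using n by linarith
    ultimately show "i \<in> (\<Union>k<K. \<Union>m<n. (\<lambda>j. (k, m, j)) ` {..<fst (\<omega> (k, m))})"
      by (simp add: image_iff)
  qed
  then have "finite I"
    by (rule finite_subset) auto
  then obtain i where i: "i \<in> I" "\<forall>i'\<in>I. precedes \<omega> i i'"
    using finite_first[of I \<omega>] hit unfolding I_def by blast
  have "precedes \<omega> i i'" if "hits W \<omega> i'" for i'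
  proof (cases "arrival \<omega> i' < T")
    case True
    then show ?thesis using i that by (simp add: I_def del: split_paired_All)
  next
    case False
    then show ?thesis using i by (simp add: I_def precedes_def)
  qed
  with i show ?thesis
    unfolding I_def first_hit_def by blast
qed

section \<open>Measurability and void probabilities of the process\<close>

context
  fixes Q :: "'a measure"
  assumes Q: "prob_space Q"
begin

interpretation Q: prob_space Q by fact
interpretation U: prob_space unit_uniform by (rule prob_space_unit_uniform)
interpretation QU: pair_prob_space Q unit_uniform ..

lemma prob_space_poisson_cell: "prob_space (poisson_cell Q)"
proof -
  interpret Z: prob_space "\<Pi>\<^sub>M j\<in>(UNIV::nat set). Q \<Otimes>\<^sub>M unit_uniform"
    by (intro prob_space_PiM) unfold_locales
  interpret N: prob_space "measure_pmf (poisson_pmf 1)"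
    by (rule prob_space_measure_pmf)
  interpret pair_prob_space "measure_pmf (poisson_pmf 1)" "\<Pi>\<^sub>M j\<in>(UNIV::nat set). Q \<Otimes>\<^sub>M unit_uniform" ..
  show ?thesis unfolding poisson_cell_def by unfold_locales
qed

lemma prob_space_poisson_space: "prob_space (poisson_space Q)"
  unfolding poisson_space_def by (intro prob_space_PiM prob_space_poisson_cell)

text \<open>With \<open>v\<close> the measure of \<open>V\<close>, a cell of \<open>N\<close> points
  avoids \<open>V\<close> with probability \<open>(1 - v) ^ N\<close>. Averaging over the Poisson
  weights gives an exponential series with value \<open>exp (- 1) * exp (1 - v)\<close>.\<close>

lemma measure_poisson_cell_void:
  assumes V [measurable]: "V \<in> sets (Q \<Otimes>\<^sub>M unit_uniform)"
  shows "{x \<in> space (poisson_cell Q). \<forall>j<fst x. snd x j \<notin> V} \<in> sets (poisson_cell Q)" (is ?A)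
    and "measure (poisson_cell Q) {x \<in> space (poisson_cell Q). \<forall>j<fst x. snd x j \<notin> V} =
      exp (- measure (Q \<Otimes>\<^sub>M unit_uniform) V)" (is ?B)
proof -
  let ?Z = "\<Pi>\<^sub>M j\<in>(UNIV::nat set). Q \<Otimes>\<^sub>M unit_uniform"
  let ?S = "{x \<in> space (poisson_cell Q). \<forall>j<fst x. snd x j \<notin> V}"
  interpret Z: product_prob_space "\<lambda>_. Q \<Otimes>\<^sub>M unit_uniform" UNIV ..
  interpret N: prob_space "measure_pmf (poisson_pmf 1)"
    by (rule prob_space_measure_pmf)
  have [measurable]: "fst \<in> measure_pmf (poisson_pmf 1) \<Otimes>\<^sub>M ?Z \<rightarrow>\<^sub>M count_space UNIV"
    using measurable_fst[of "measure_pmf (poisson_pmf 1)" ?Z] by simp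
  show S: ?A
    unfolding poisson_cell_def by measurable
  define v where "v = measure (Q \<Otimes>\<^sub>M unit_uniform) V"
  have v: "0 \<le> v" "v \<le> 1" by (auto simp: v_def)
  have slice: "emeasure ?Z (Pair N -` ?S) = ennreal ((1 - v) ^ N)" for N
  proof -
    have "Pair N -` ?S = {z \<in> space ?Z. \<forall>j\<in>{..<N}. z j \<in> space (Q \<Otimes>\<^sub>M unit_uniform) - V}"
      by (auto simp: poisson_cell_def space_pair_measure space_PiM PiE_iff)
    also have "emeasure ?Z \<dots> = (\<Prod>j<N. emeasure (Q \<Otimes>\<^sub>M unit_uniform) (space (Q \<Otimes>\<^sub>M unit_uniform) - V))"
      by (rule Z.emeasure_PiM_Collect) (auto intro!: sets.Diff V)
    also have "\<dots> = ennreal ((1 - v) ^ N)"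
      using v by (simp add: QU.emeasure_eq_measure QU.prob_compl[OF V] v_def ennreal_power)
    finally show ?thesis .
  qed
  have "emeasure (poisson_cell Q) ?S = (\<integral>\<^sup>+N. emeasure ?Z (Pair N -` ?S) \<partial>measure_pmf (poisson_pmf 1))"
    using S unfolding poisson_cell_def by (rule Z.emeasure_pair_measure_alt)
  also have "\<dots> = (\<Sum>N. ennreal (exp (- 1) / fact N) * ennreal ((1 - v) ^ N))"
    unfolding slice nn_integral_measure_pmf by (simp add: nn_integral_count_space_nat)
  also have "\<dots> = (\<Sum>N. ennreal (exp (- 1) * ((1 - v) ^ N /\<^sub>R fact N)))"
    using v by (intro suminf_cong) (simp add: ennreal_mult[symmetric] divide_inverse mult_ac)
  also have "\<dots> = ennreal (exp (- 1) * exp (1 - v))"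
    using v by (intro suminf_ennreal_eq sums_mult exp_converges) simp
  also have "exp (- 1) * exp (1 - v) = exp (- v)"
    by (simp add: exp_add[symmetric])
  finally show ?B
    unfolding v_def by (simp add: measure_eq_emeasure_eq_ennreal)
qed

end

text \<open>The two regions have separate deadlines because, in the race of \<open>B\<close> against
  \<open>C\<close>, \<open>B\<close> has to be avoided up to one grid time and \<open>C\<close> up
  to the next.\<close>

definition unhit ::
  "'a measure \<Rightarrow> (nat \<Rightarrow> 'a set) \<Rightarrow> real \<Rightarrow> (nat \<Rightarrow> 'a set) \<Rightarrow> real \<Rightarrow> 'a configuration set" where
  "unhit Q B s C t = {\<omega> \<in> space (poisson_space Q).
    (\<forall>i. hits B \<omega> i \<longrightarrow> s \<le> arrival \<omega> i) \<and> (\<forall>i. hits C \<omega> i \<longrightarrow> t \<le> arrival \<omega> i)}"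

context
  fixes Q :: "'a measure"
  assumes Q: "prob_space Q"
begin

interpretation Q: prob_space Q by fact
interpretation U: prob_space unit_uniform by (rule prob_space_unit_uniform)
interpretation QU: pair_prob_space Q unit_uniform ..
interpretation \<Omega>: prob_space "poisson_space Q" by (rule prob_space_poisson_space[OF Q])

lemma measurable_poisson_cell_count: "fst \<in> poisson_cell Q \<rightarrow>\<^sub>M count_space UNIV"
  unfolding poisson_cell_def
  using measurable_fst[of "measure_pmf (poisson_pmf 1)" "\<Pi>\<^sub>M j\<in>(UNIV::nat set). Q \<Otimes>\<^sub>M unit_uniform"]
  by simp

lemma measurable_poisson_space_count [measurable]:
  "(\<lambda>\<omega>. fst (\<omega> c)) \<in> poisson_space Q \<rightarrow>\<^sub>M count_space UNIV"
  unfolding poisson_space_def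
  by (rule measurable_compose[where N = "poisson_cell Q" and f = "\<lambda>\<omega>. \<omega> c"])
     (auto intro: measurable_poisson_cell_count)

lemma measurable_poisson_space_mark [measurable]:
  "(\<lambda>\<omega>. snd (\<omega> c) j) \<in> poisson_space Q \<rightarrow>\<^sub>M Q \<Otimes>\<^sub>M unit_uniform"
proof -
  have "(\<lambda>x. snd x j) \<in> poisson_cell Q \<rightarrow>\<^sub>M Q \<Otimes>\<^sub>M unit_uniform"
    unfolding poisson_cell_def by measurable
  then show ?thesis
    unfolding poisson_space_def
    by (rule measurable_compose[where N = "poisson_cell Q" and f = "\<lambda>\<omega>. \<omega> c", rotated]) simp
qed

lemma measurable_poisson_space_time [measurable]:
  "(\<lambda>\<omega>. snd (snd (\<omega> c) j)) \<in> borel_measurable (poisson_space Q)"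
  using measurable_compose[OF measurable_poisson_space_mark measurable_snd]
  by (simp cong: measurable_cong_sets add: sets_unit_uniform)

lemma measurable_point [measurable]: "(\<lambda>\<omega>. point \<omega> i) \<in> poisson_space Q \<rightarrow>\<^sub>M Q"
  by (cases i) (simp add: point_def)

lemma measurable_arrival [measurable]: "(\<lambda>\<omega>. arrival \<omega> i) \<in> borel_measurable (poisson_space Q)"
  unfolding arrival_def by (cases i) simp

lemma measurable_active [measurable]: "Measurable.pred (poisson_space Q) (\<lambda>\<omega>. active \<omega> i)"
  by (cases i) (simp add: active_def)

lemma measurable_hits [measurable]:
  assumes [measurable]: "\<And>k. W k \<in> sets Q"
  shows "Measurable.pred (poisson_space Q) (\<lambda>\<omega>. hits W \<omega> i)"
  unfolding hits_def by measurable

lemma measurable_precedes [measurable]: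
  "Measurable.pred (poisson_space Q) (\<lambda>\<omega>. precedes \<omega> i i')"
proof -
  have "Measurable.pred (poisson_space Q) (\<lambda>\<omega>. arrival \<omega> i < arrival \<omega> i')"
    "Measurable.pred (poisson_space Q) (\<lambda>\<omega>. arrival \<omega> i \<le> arrival \<omega> i')"
    by (rule borel_measurable_pred_less; measurable)
      (unfold not_less[symmetric], measurable)
  then show ?thesis
    unfolding precedes_def by (cases "to_nat i \<le> to_nat i'") auto
qed

lemma measurable_first_hit [measurable]:
  assumes [measurable]: "\<And>k. W k \<in> sets Q"
  shows "Measurable.pred (poisson_space Q) (\<lambda>\<omega>. first_hit W \<omega> i)"
  unfolding first_hit_def by measurable

lemma sum_box:
  fixes x y :: "nat \<Rightarrow> real"
  shows "(\<Sum>c\<in>{..<n} \<times> {..<n}. x (fst c) * y (snd c)) = (\<Sum>k<n. x k) * (\<Sum>m<n. y m)"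
  by (simp add: sum_product sum.cartesian_product case_prod_unfold)

text \<open>Cells are independent, so void probabilities multiply over a finite box of cells, and
  continuity from above passes to all cells. By \<open>eq\<close> the mass of a cell is a sum of two
  products of a level factor and a time factor, which makes the sums over a box factorize.\<close>

lemma measure_poisson_space_void:
  assumes V [measurable]: "\<And>c. V c \<in> sets (Q \<Otimes>\<^sub>M unit_uniform)"
    and eq: "\<And>k m. measure (Q \<Otimes>\<^sub>M unit_uniform) (V (k, m)) = x k * y m + x' k * y' m"
    and sums: "x sums b" "y sums s" "x' sums b'" "y' sums s'"
  shows "measure (poisson_space Q) {\<omega> \<in> space (poisson_space Q). \<forall>c. \<forall>j<fst (\<omega> c). snd (\<omega> c) j \<notin> V c} =
    exp (- (b * s + b' * s'))"
proof -
  let ?X = "\<lambda>c. {x \<in> space (poisson_cell Q). \<forall>j<fst x. snd x j \<notin> V c}"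
  define E where "E n = {\<omega> \<in> space (poisson_space Q). \<forall>c\<in>{..<n} \<times> {..<n}. \<omega> c \<in> ?X c}" for n :: nat
  interpret C: prob_space "poisson_cell Q" by (rule prob_space_poisson_cell[OF Q])
  interpret P: product_prob_space "\<lambda>_. poisson_cell Q" "UNIV :: (nat \<times> nat) set" ..
  have X: "?X c \<in> sets (poisson_cell Q)" for c
    by (rule measure_poisson_cell_void[OF Q V])
  have E: "E n \<in> sets (poisson_space Q)" for n
    unfolding E_def poisson_space_def using X by measurable
  have "emeasure (poisson_space Q) (E n) = (\<Prod>c\<in>{..<n} \<times> {..<n}. emeasure (poisson_cell Q) (?X c))" for n
    unfolding E_def poisson_space_def by (intro P.emeasure_PiM_Collect X) auto
  also have "\<dots> n = ennreal (\<Prod>c\<in>{..<n} \<times> {..<n}. exp (- measure (Q \<Otimes>\<^sub>M unit_uniform) (V c)))" for n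
    by (simp add: C.emeasure_eq_measure measure_poisson_cell_void[OF Q V] prod_ennreal)
  finally have "measure (poisson_space Q) (E n) =
      (\<Prod>c\<in>{..<n} \<times> {..<n}. exp (- measure (Q \<Otimes>\<^sub>M unit_uniform) (V c)))" for n
    by (simp add: measure_eq_emeasure_eq_ennreal prod_nonneg)
  also have "\<dots> n = exp (- (\<Sum>c\<in>{..<n} \<times> {..<n}. x (fst c) * y (snd c) + x' (fst c) * y' (snd c)))" for n
    by (subst sum.cong[OF refl, of _ _ "\<lambda>c. measure (Q \<Otimes>\<^sub>M unit_uniform) (V c)"])
       (auto simp: exp_sum[symmetric] sum_negf eq)
  also have "\<dots> n = exp (- ((\<Sum>k<n. x k) * (\<Sum>m<n. y m) + (\<Sum>k<n. x' k) * (\<Sum>m<n. y' m)))" for n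
    by (simp only: sum.distrib sum_box)
  finally have *: "measure (poisson_space Q) (E n) =
    exp (- ((\<Sum>k<n. x k) * (\<Sum>m<n. y m) + (\<Sum>k<n. x' k) * (\<Sum>m<n. y' m)))" for n .
  have "(\<lambda>n. measure (poisson_space Q) (E n)) \<longlonglongrightarrow> exp (- (b * s + b' * s'))"
    unfolding * using sums unfolding sums_def by (intro tendsto_intros)
  moreover have "(\<lambda>n. measure (poisson_space Q) (E n)) \<longlonglongrightarrow> measure (poisson_space Q) (\<Inter>n. E n)"
    using E by (intro \<Omega>.finite_Lim_measure_decseq) (auto simp: decseq_def E_def)
  moreover have "(\<Inter>n. E n) = {\<omega> \<in> space (poisson_space Q). \<forall>c. \<forall>j<fst (\<omega> c). snd (\<omega> c) j \<notin> V c}"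
  proof (intro set_eqI iffI)
    fix \<omega> assume \<omega>: "\<omega> \<in> (\<Inter>n. E n)"
    have "snd (\<omega> (k, m)) j \<notin> V (k, m)" if "j < fst (\<omega> (k, m))" for k m j
      using \<omega>[THEN INT_D, of "Suc (max k m)"] that unfolding E_def by force
    with \<omega> show "\<omega> \<in> {\<omega> \<in> space (poisson_space Q). \<forall>c. \<forall>j<fst (\<omega> c). snd (\<omega> c) j \<notin> V c}"
      unfolding E_def by auto
  qed (auto simp: E_def poisson_space_def space_PiM PiE_iff)
  ultimately show ?thesis
    using LIMSEQ_unique by metis
qed

lemma sets_unhit [measurable]:
  assumes [measurable]: "\<And>k. B k \<in> sets Q" "\<And>k. C k \<in> sets Q"
  shows "unhit Q B s C t \<in> sets (poisson_space Q)"
  unfolding unhit_def by measurable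

lemma measure_unhit:
  assumes B [measurable]: "\<And>k. B k \<in> sets Q" and C [measurable]: "\<And>k. C k \<in> sets Q"
    and disj: "\<And>k. B k \<inter> C k = {}"
    and b: "(\<lambda>k. measure Q (B k)) sums b" and c: "(\<lambda>k. measure Q (C k)) sums c"
    and st: "0 \<le> s" "0 \<le> t"
  shows "measure (poisson_space Q) (unhit Q B s C t) = exp (- (b * s + c * t))"
proof -
  let ?T = "\<lambda>x. {\<tau>. 0 \<le> \<tau> \<and> \<tau> < x} :: real set"
  \<comment> \<open>A point of slot \<open>m\<close> arrives before \<open>s\<close> iff its time
    within the slot is below \<open>s - real m\<close>. The resulting strip has length
    \<open>clip (s - real m)\<close>, and these lengths add up to \<open>s\<close>.\<close>
  define V where "V = (\<lambda>(k, m). B k \<times> ?T (s - real m) \<union> C k \<times> ?T (t - real m))"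
  have T [measurable]: "?T x \<in> sets unit_uniform" for x
    by measurable
  have "measure (Q \<Otimes>\<^sub>M unit_uniform) (X \<times> ?T x) = measure Q X * clip x" if [measurable]: "X \<in> sets Q" for X x
    by (simp add: measure_def U.emeasure_pair_measure_Times enn2real_mult
        measure_unit_uniform_less[unfolded measure_def])
  then have eq: "measure (Q \<Otimes>\<^sub>M unit_uniform) (V (k, m)) =
      measure Q (B k) * clip (s - real m) + measure Q (C k) * clip (t - real m)" for k m
    using disj[of k] unfolding V_def prod.case by (subst QU.finite_measure_Union) auto
  have "unhit Q B s C t = {\<omega> \<in> space (poisson_space Q). \<forall>c. \<forall>j<fst (\<omega> c). snd (\<omega> c) j \<notin> V c}"
    unfolding unhit_def hits_def active_def arrival_def point_def V_def
    by (fastforce simp: mem_Times_iff not_le not_less)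
  then show ?thesis
    using measure_poisson_space_void[of V, OF _ eq b clip_sums[OF st(1)] c clip_sums[OF st(2)]]
    by (simp add: V_def case_prod_unfold)
qed

end

subsection \<open>The earliest point in a region\<close>

text \<open>With time cut into steps of length \<delta>, the expression is the probability that some
  step sees the first hit of \<open>B\<close> while \<open>C\<close> is still unhit at its end. To
  first order the numerator is \<open>\<delta> * b\<close> and the denominator
  \<open>\<delta> * (b + c)\<close>.\<close>

lemma tendsto_race:
  assumes "0 < b" "0 \<le> c"
  shows "((\<lambda>\<delta>::real. exp (- (\<delta> * c)) * (1 - exp (- (\<delta> * b))) / (1 - exp (- (\<delta> * (b + c))))) \<longlongrightarrow> b / (b + c)) (at_right 0)"
proof -
  have "0 < b + c" using assms by simp
  moreover have "b / (b + c) = b * inverse (c + b)"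
    by (simp add: divide_inverse add.commute)
  ultimately show ?thesis
    using assms(1) by (simp only:) real_asymp
qed

context
  fixes Q :: "'a measure"
  assumes Q: "prob_space Q"
begin

interpretation \<Omega>: prob_space "poisson_space Q" by (rule prob_space_poisson_space[OF Q])

declare measurable_first_hit[OF Q, measurable] measurable_point[OF Q, measurable]
  sets_unhit[OF Q, measurable]

lemma sets_first_hit_in:
  assumes [measurable]: "\<And>k. W k \<in> sets Q" "\<And>k. B k \<in> sets Q"
  shows "{\<omega> \<in> space (poisson_space Q). \<exists>i. first_hit W \<omega> i \<and> point \<omega> i \<in> B (fst i)} \<in> sets (poisson_space Q)"
  by measurable

text \<open>Boundedness of \<open>B\<close> guarantees that only finitely many points of \<open>B\<close> arrive before a given time.\<close>

lemma measure_first_hit_in_ge_bounded: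
  assumes B [measurable]: "\<And>k. B k \<in> sets Q" and C [measurable]: "\<And>k. C k \<in> sets Q"
    and disj: "\<And>k. B k \<inter> C k = {}"
    and b: "(\<lambda>k. measure Q (B k)) sums b" and c: "(\<lambda>k. measure Q (C k)) sums c"
    and bounded: "\<And>k. K \<le> k \<Longrightarrow> B k = {}"
  shows "b / (b + c) \<le> measure (poisson_space Q)
    {\<omega> \<in> space (poisson_space Q). \<exists>i. first_hit (\<lambda>k. B k \<union> C k) \<omega> i \<and> point \<omega> i \<in> B (fst i)}"
    (is "_ \<le> measure _ ?Win")
proof (cases "b = 0")
  \<comment> \<open>For \<open>b = 0\<close> the bound is trivial. Otherwise \<open>b + c\<close> is
    positive, as the geometric series and the limit below require.\<close>
  case False
  have nonneg: "0 \<le> b" "0 \<le> c"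
    using sums_le[OF _ sums_zero b] sums_le[OF _ sums_zero c] by auto
  with False have pos: "0 < b" by simp
  have Win: "?Win \<in> sets (poisson_space Q)"
    by (rule sets_first_hit_in) auto
  \<comment> \<open>\<open>E l\<close> is the event that the first hit of \<open>B\<close> falls in \<open>[l \<delta>, (l + 1) \<delta>)\<close> while \<open>C\<close> is not hit before
    \<open>(l + 1) \<delta>\<close>. Its probability is a difference of two void probabilities, and \<open>\<delta>\<close> tends to \<open>0\<close>.\<close>
  have "exp (- (\<delta> * c)) * (1 - exp (- (\<delta> * b))) / (1 - exp (- (\<delta> * (b + c)))) \<le> measure (poisson_space Q) ?Win"
    if \<delta>: "0 < \<delta>" for \<delta>
  proof -
    define E where "E l = unhit Q B (real l * \<delta>) C (real (Suc l) * \<delta>) -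
      unhit Q B (real (Suc l) * \<delta>) C (real (Suc l) * \<delta>)" for l
    have sets_E: "E l \<in> sets (poisson_space Q)" for l
      unfolding E_def by measurable
    have unhit_mono: "unhit Q B s' C t' \<subseteq> unhit Q B s C t" if "s \<le> s'" "t \<le> t'" for s t s' t'
      using that unfolding unhit_def by (auto intro: order_trans simp del: split_paired_All)
    have E_Win: "E l \<subseteq> ?Win" for l
    proof
      fix \<omega> assume \<omega>: "\<omega> \<in> E l"
      let ?T = "real (Suc l) * \<delta>"
      from \<omega> have "\<omega> \<in> space (poisson_space Q)" and noC: "\<And>i. hits C \<omega> i \<Longrightarrow> ?T \<le> arrival \<omega> i"
        unfolding E_def unhit_def by blast+
      from \<omega> noC obtain i\<^sub>0 where i\<^sub>0: "hits B \<omega> i\<^sub>0" "arrival \<omega> i\<^sub>0 < ?T"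
        unfolding E_def unhit_def by fastforce
      have inB: "point \<omega> i \<in> B (fst i)" if "hits (\<lambda>k. B k \<union> C k) \<omega> i" "arrival \<omega> i < ?T" for i
        using that noC[of i] unfolding hits_def by auto
      have "\<exists>i. first_hit (\<lambda>k. B k \<union> C k) \<omega> i \<and> arrival \<omega> i < ?T"
      proof (rule ex_first_hit)
        show "hits (\<lambda>k. B k \<union> C k) \<omega> i\<^sub>0"
          using i\<^sub>0(1) by (rule hits_mono) simp
        show "fst i < K" if "hits (\<lambda>k. B k \<union> C k) \<omega> i" "arrival \<omega> i < ?T" for i
          using inB[OF that] bounded[of "fst i"] by (cases "fst i < K") auto
      qed (rule i\<^sub>0)
      with inB \<open>\<omega> \<in> space _\<close> show "\<omega> \<in> ?Win"
        unfolding first_hit_def by blast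
    qed
    have "disjoint_family E"
      unfolding disjoint_family_on_def
    proof (intro ballI impI)
      \<comment> \<open>\<open>E l'\<close> lies in the void event with deadlines
        \<open>real l' * \<delta>\<close> and later, hence in the event that \<open>E l\<close>
        removes.\<close>
      have *: "E l \<inter> E l' = {}" if "l < l'" for l l'
      proof -
        from that have "real (Suc l) * \<delta> \<le> real l' * \<delta>" "real (Suc l) * \<delta> \<le> real (Suc l') * \<delta>"
          using \<delta> by (intro mult_right_mono; simp)+
        then show ?thesis
          using unhit_mono unfolding E_def by blast
      qed
      fix l l' :: nat assume "l \<noteq> l'"
      then show "E l \<inter> E l' = {}"
        using *[of l l'] *[of l' l] by (cases "l < l'") auto
    qed
    then have sums_E: "(\<lambda>l. measure (poisson_space Q) (E l)) sums measure (poisson_space Q) (\<Union>l. E l)"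
      using sets_E by (intro \<Omega>.finite_measure_UNION) auto
    have mE: "measure (poisson_space Q) (E l) =
        exp (- (\<delta> * c)) * (1 - exp (- (\<delta> * b))) * exp (- (\<delta> * (b + c))) ^ l" for l
    proof -
      have "measure (poisson_space Q) (E l) =
          exp (- (b * (real l * \<delta>) + c * (real (Suc l) * \<delta>))) -
          exp (- (b * (real (Suc l) * \<delta>) + c * (real (Suc l) * \<delta>)))"
        unfolding E_def using \<delta> unhit_mono[of "real l * \<delta>" "real (Suc l) * \<delta>"]
        by (subst \<Omega>.finite_measure_Diff) (simp_all add: measure_unhit[OF Q B C disj b c])
      also have "\<dots> = exp (- (\<delta> * c)) * (1 - exp (- (\<delta> * b))) * exp (- (\<delta> * (b + c))) ^ l"
        by (simp add: exp_of_nat_mult[symmetric] algebra_simps exp_add[symmetric])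
      finally show ?thesis .
    qed
    have "exp (- (\<delta> * (b + c))) < 1"
      using pos nonneg \<delta> by simp
    then have "(\<lambda>l. measure (poisson_space Q) (E l)) sums
        (exp (- (\<delta> * c)) * (1 - exp (- (\<delta> * b))) * (1 / (1 - exp (- (\<delta> * (b + c))))))"
      unfolding mE by (intro sums_mult geometric_sums) simp
    with sums_E have "exp (- (\<delta> * c)) * (1 - exp (- (\<delta> * b))) / (1 - exp (- (\<delta> * (b + c)))) =
        measure (poisson_space Q) (\<Union>l. E l)"
      using sums_unique2 by fastforce
    also have "\<dots> \<le> measure (poisson_space Q) ?Win"
      using E_Win Win by (intro \<Omega>.finite_measure_mono UN_least)
    finally show ?thesis .
  qed
  then show ?thesis
    by (intro tendsto_upperbound[OF tendsto_race[OF pos nonneg(2)]])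
       (auto simp: eventually_at_filter)
qed simp

text \<open>Levels of \<open>B\<close> from \<open>K\<close> on are handed to the competitor. This
  keeps the union, hence the first hit, and can only lower the chance of \<open>B\<close>; then
  \<open>K\<close> tends to infinity.\<close>

lemma measure_first_hit_in_ge:
  assumes B [measurable]: "\<And>k. B k \<in> sets Q" and C [measurable]: "\<And>k. C k \<in> sets Q"
    and disj: "\<And>k. B k \<inter> C k = {}"
    and b: "(\<lambda>k. measure Q (B k)) sums b" and c: "(\<lambda>k. measure Q (C k)) sums c"
  shows "b / (b + c) \<le> measure (poisson_space Q)
    {\<omega> \<in> space (poisson_space Q). \<exists>i. first_hit (\<lambda>k. B k \<union> C k) \<omega> i \<and> point \<omega> i \<in> B (fst i)}"
    (is "_ \<le> measure _ ?Win")
proof -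
  interpret Q: prob_space Q by fact
  have "(\<Sum>k<K. measure Q (B k)) / (b + c) \<le> measure (poisson_space Q) ?Win" for K
  proof -
    define B' where "B' k = (if k < K then B k else {})" for k
    define C' where "C' k = (if k < K then C k else B k \<union> C k)" for k
    have [measurable]: "B' k \<in> sets Q" "C' k \<in> sets Q" for k
      by (auto simp: B'_def C'_def)
    have un: "(\<lambda>k. B' k \<union> C' k) = (\<lambda>k. B k \<union> C k)"
      by (rule ext) (auto simp: B'_def C'_def)
    have b': "(\<lambda>k. measure Q (B' k)) sums (\<Sum>k<K. measure Q (B k))"
      using sums_If_finite_set[of "{..<K}" "\<lambda>k. measure Q (B k)"]
      by (simp add: B'_def if_distrib[of "measure Q"] cong: if_cong)
    have split: "measure Q (C' k) = measure Q (B k) + measure Q (C k) - measure Q (B' k)" for k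
      using disj[of k] Q.finite_measure_Union[OF B C, of k k] by (simp add: B'_def C'_def)
    have c': "(\<lambda>k. measure Q (C' k)) sums (b + c - (\<Sum>k<K. measure Q (B k)))"
      unfolding split by (intro sums_diff sums_add b c b')
    have "(\<Sum>k<K. measure Q (B k)) / ((\<Sum>k<K. measure Q (B k)) + (b + c - (\<Sum>k<K. measure Q (B k)))) \<le>
        measure (poisson_space Q) {\<omega> \<in> space (poisson_space Q). \<exists>i. first_hit (\<lambda>k. B k \<union> C k) \<omega> i \<and> point \<omega> i \<in> B' (fst i)}"
      using disj by (subst un[symmetric], intro measure_first_hit_in_ge_bounded[OF _ _ _ b' c', of K])
        (auto simp: B'_def C'_def)
    also have "\<dots> \<le> measure (poisson_space Q) ?Win"
      by (intro \<Omega>.finite_measure_mono sets_first_hit_in) (auto simp: B'_def split: if_splits)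
    finally show ?thesis by simp
  qed
  \<comment> \<open>If \<open>b + c = 0\<close>, every quotient is \<open>0\<close> by the
    convention for division by zero.\<close>
  moreover have "(\<lambda>K. (\<Sum>k<K. measure Q (B k)) / (b + c)) \<longlonglongrightarrow> b / (b + c)"
    using b[unfolded sums_def] by (cases "b + c = 0") (auto intro!: tendsto_intros)
  ultimately show ?thesis
    by (intro LIMSEQ_le_const2) auto
qed

end

subsection \<open>Sampling from a density\<close>

text \<open>The subgraph of \<phi> above height \<open>k\<close>, moved down by \<open>k\<close>.
  Since \<open>unit_uniform\<close> charges only \<open>[0, 1)\<close>, level \<open>k\<close>
  accounts for the heights in \<open>[k, k + 1)\<close>.\<close>

definition below :: "'h measure \<Rightarrow> ('h \<Rightarrow> real) \<Rightarrow> nat \<Rightarrow> ('h \<times> real) set" where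
  "below P \<phi> k = {(h, u). h \<in> space P \<and> 0 \<le> u \<and> real k + u < \<phi> h}"

text \<open>If nothing is hit, \<open>THE\<close> denotes a fixed index, which keeps \<open>pick\<close> measurable.\<close>

definition pick :: "'h measure \<Rightarrow> ('h \<Rightarrow> real) \<Rightarrow> ('h \<times> real) configuration \<Rightarrow> 'h" where
  "pick P \<phi> \<omega> = fst (point \<omega> (THE i. first_hit (below P \<phi>) \<omega> i))"

lemma pick_eq: "first_hit (below P \<phi>) \<omega> i \<Longrightarrow> pick P \<phi> \<omega> = fst (point \<omega> i)"
  unfolding pick_def by (metis the_equality first_hit_unique)

text \<open>Applying the inequality to complements reverses it. This is why lower bounds on winning
  probabilities determine the law of the output.\<close>

lemma prob_measure_eqI:
  assumes "prob_space M" "prob_space N" and sets: "sets M = sets N"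
    and le: "\<And>X. X \<in> sets M \<Longrightarrow> measure M X \<le> measure N X"
  shows "M = N"
proof (rule measure_eqI[OF sets])
  interpret M: prob_space M by fact
  interpret N: prob_space N by fact
  fix X assume X: "X \<in> sets M"
  then have "1 - measure M X \<le> 1 - measure N X"
    using le[of "space M - X"] M.prob_compl[of X] N.prob_compl[of X] sets_eq_imp_space_eq[OF sets] sets
    by simp
  with le[OF X] show "emeasure M X = emeasure N X"
    by (simp add: M.emeasure_eq_measure N.emeasure_eq_measure)
qed

context
  fixes P :: "'h measure"
  assumes P: "prob_space P"
begin

interpretation P: prob_space P by fact
interpretation U: prob_space unit_uniform by (rule prob_space_unit_uniform)
interpretation PU: pair_prob_space P unit_uniform ..

lemma prob_space_marked: "prob_space (P \<Otimes>\<^sub>M unit_uniform)"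
  by unfold_locales

lemmas Q = prob_space_marked

interpretation \<Omega>: prob_space "poisson_space (P \<Otimes>\<^sub>M unit_uniform)"
  by (rule prob_space_poisson_space[OF Q])

declare measurable_first_hit[OF Q, measurable] measurable_point[OF Q, measurable]

lemma sets_below [measurable]:
  assumes [measurable]: "\<phi> \<in> borel_measurable P"
  shows "below P \<phi> k \<in> sets (P \<Otimes>\<^sub>M unit_uniform)"
proof -
  have [measurable]: "snd \<in> borel_measurable (P \<Otimes>\<^sub>M unit_uniform)"
    using measurable_snd[of P unit_uniform] by (simp add: sets_unit_uniform cong: measurable_cong_sets)
  have "below P \<phi> k = {x \<in> space (P \<Otimes>\<^sub>M unit_uniform). 0 \<le> snd x \<and> real k + snd x < \<phi> (fst x)}"
    by (auto simp: below_def space_pair_measure)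
  then show ?thesis by simp
qed

lemma measure_below:
  assumes \<phi> [measurable]: "\<phi> \<in> borel_measurable P"
  shows "measure (P \<Otimes>\<^sub>M unit_uniform) (below P \<phi> k) = (\<integral>h. clip (\<phi> h - real k) \<partial>P)"
proof -
  have slice: "emeasure unit_uniform (Pair h -` below P \<phi> k) = ennreal (clip (\<phi> h - real k))" if "h \<in> space P" for h
  proof -
    have "Pair h -` below P \<phi> k = {u. 0 \<le> u \<and> u < \<phi> h - real k}"
      using that by (auto simp: below_def)
    then show ?thesis
      by (simp add: U.emeasure_eq_measure measure_unit_uniform_less)
  qed
  have "integrable P (\<lambda>h. clip (\<phi> h - real k))"
    by (rule P.integrable_const_bound[of _ 1]) auto
  then have "emeasure (P \<Otimes>\<^sub>M unit_uniform) (below P \<phi> k) = ennreal (\<integral>h. clip (\<phi> h - real k) \<partial>P)"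
    by (simp add: U.emeasure_pair_measure_alt slice nn_integral_eq_integral cong: nn_integral_cong)
  then show ?thesis
    by (simp add: measure_eq_emeasure_eq_ennreal)
qed

text \<open>The first \<open>n\<close> layers contribute the integral of
  \<open>min (\<phi> h) (real n)\<close>; dominated convergence with majorant \<phi> removes the
  truncation.\<close>

lemma measure_below_sums:
  assumes int: "integrable P \<phi>" and nonneg: "\<And>h. 0 \<le> \<phi> h"
  shows "(\<lambda>k. measure (P \<Otimes>\<^sub>M unit_uniform) (below P \<phi> k)) sums (\<integral>h. \<phi> h \<partial>P)"
proof -
  have [measurable]: "\<phi> \<in> borel_measurable P"
    using int by simp
  have "(\<Sum>k<n. measure (P \<Otimes>\<^sub>M unit_uniform) (below P \<phi> k)) = (\<integral>h. min (\<phi> h) (real n) \<partial>P)" for n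
  proof -
    have "(\<Sum>k<n. measure (P \<Otimes>\<^sub>M unit_uniform) (below P \<phi> k)) = (\<integral>h. (\<Sum>k<n. clip (\<phi> h - real k)) \<partial>P)"
      by (subst Bochner_Integration.integral_sum)
         (auto simp: measure_below intro!: P.integrable_const_bound[of _ 1])
    then show ?thesis
      by (simp add: sum_clip nonneg)
  qed
  moreover have "(\<lambda>n. \<integral>h. min (\<phi> h) (real n) \<partial>P) \<longlonglongrightarrow> (\<integral>h. \<phi> h \<partial>P)"
  proof (rule integral_dominated_convergence[where w = \<phi>])
    show "AE h in P. (\<lambda>n. min (\<phi> h) (real n)) \<longlonglongrightarrow> \<phi> h"
    proof (rule AE_I2)
      fix h
      obtain N where "\<phi> h \<le> real N"
        using real_arch_simple by blast
      then have "\<forall>\<^sub>F n in sequentially. min (\<phi> h) (real n) = \<phi> h"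
        by (auto intro!: eventually_sequentiallyI[of N])
      then show "(\<lambda>n. min (\<phi> h) (real n)) \<longlonglongrightarrow> \<phi> h"
        by (rule tendsto_eventually)
    qed
  qed (use int nonneg in auto)
  ultimately show ?thesis
    unfolding sums_def by simp
qed

lemma measurable_pick [measurable]:
  assumes [measurable]: "\<phi> \<in> borel_measurable P"
  shows "pick P \<phi> \<in> poisson_space (P \<Otimes>\<^sub>M unit_uniform) \<rightarrow>\<^sub>M P"
proof -
  have "(\<lambda>\<omega>. THE i. first_hit (below P \<phi>) \<omega> i) \<in> poisson_space (P \<Otimes>\<^sub>M unit_uniform) \<rightarrow>\<^sub>M count_space UNIV"
  proof (rule measurable_THE[where I = UNIV])
    show "Measurable.pred (poisson_space (P \<Otimes>\<^sub>M unit_uniform)) (\<lambda>\<omega>. first_hit (below P \<phi>) \<omega> i)" for i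
      by simp
    show "i = j" if "first_hit (below P \<phi>) \<omega> i" "first_hit (below P \<phi>) \<omega> j" for \<omega> i j
      using that by (rule first_hit_unique)
  qed simp_all
  then show ?thesis
    unfolding pick_def by (rule measurable_compose_countable[rotated]) measurable
qed

lemma measure_density_eq:
  assumes int: "integrable P \<phi>" and nonneg: "\<And>h. 0 \<le> \<phi> h" and X [measurable]: "X \<in> sets P"
  shows "measure (density P \<phi>) X = (\<integral>h. indicator X h * \<phi> h \<partial>P)"
proof -
  have [measurable]: "\<phi> \<in> borel_measurable P"
    using int by simp
  have "emeasure (density P \<phi>) X = (\<integral>\<^sup>+h. ennreal (indicator X h * \<phi> h) \<partial>P)"
    by (subst emeasure_density) (auto simp: indicator_def intro!: nn_integral_cong)
  also have "\<dots> = ennreal (\<integral>h. indicator X h * \<phi> h \<partial>P)"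
    using int nonneg integrable_mult_indicator[OF X int] by (intro nn_integral_eq_integral) auto
  finally show ?thesis
    using nonneg by (simp add: measure_eq_emeasure_eq_ennreal)
qed

text \<open>The subgraph of \<phi> splits into the part over \<open>X\<close> and the part over its
  complement, of total mass \<open>1\<close>. The first part wins the race with probability at least
  its own mass.\<close>

lemma distr_pick:
  assumes int: "integrable P \<phi>" and nonneg: "\<And>h. 0 \<le> \<phi> h" and one: "(\<integral>h. \<phi> h \<partial>P) = 1"
  shows "distr (poisson_space (P \<Otimes>\<^sub>M unit_uniform)) P (pick P \<phi>) = density P \<phi>"
proof (rule sym, rule prob_measure_eqI)
  have [measurable]: "\<phi> \<in> borel_measurable P"
    using int by simp
  show "prob_space (distr (poisson_space (P \<Otimes>\<^sub>M unit_uniform)) P (pick P \<phi>))"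
    by (rule \<Omega>.prob_space_distr) simp
  show "prob_space (density P \<phi>)"
    using nn_integral_eq_integral[OF int] nonneg one
    by (intro prob_spaceI) (simp add: emeasure_density cong: nn_integral_cong)
  fix X assume "X \<in> sets (density P \<phi>)"
  then have X [measurable]: "X \<in> sets P" by simp
  let ?in = "\<lambda>h. indicator X h * \<phi> h" and ?out = "\<lambda>h. indicator (space P - X) h * \<phi> h"
  have intio: "integrable P ?in" "integrable P ?out"
    using integrable_mult_indicator[OF X int] integrable_mult_indicator[of "space P - X" P \<phi>] int by auto
  have "(\<integral>h. \<phi> h \<partial>P) = (\<integral>h. ?in h + ?out h \<partial>P)"
    by (rule Bochner_Integration.integral_cong) (auto simp: indicator_def)
  also have "\<dots> = (\<integral>h. ?in h \<partial>P) + (\<integral>h. ?out h \<partial>P)"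
    using intio by (rule Bochner_Integration.integral_add)
  finally have sum1: "(\<integral>h. ?in h \<partial>P) + (\<integral>h. ?out h \<partial>P) = 1"
    by (simp add: one)
  have un: "(\<lambda>k. below P ?in k \<union> below P ?out k) = below P \<phi>"
    by (rule ext) (auto simp: below_def indicator_def split: split_of_bool_asm split_of_bool)
  let ?Win = "{\<omega> \<in> space (poisson_space (P \<Otimes>\<^sub>M unit_uniform)).
      \<exists>i. first_hit (below P \<phi>) \<omega> i \<and> point \<omega> i \<in> below P ?in (fst i)}"
  have "(\<integral>h. ?in h \<partial>P) / ((\<integral>h. ?in h \<partial>P) + (\<integral>h. ?out h \<partial>P)) \<le> measure (poisson_space (P \<Otimes>\<^sub>M unit_uniform)) ?Win"
    unfolding un[symmetric]
    by (intro measure_first_hit_in_ge[OF Q] measure_below_sums intio sets_below)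
       (auto simp: nonneg below_def indicator_def split: split_of_bool_asm split_of_bool)
  also have "\<dots> \<le> measure (poisson_space (P \<Otimes>\<^sub>M unit_uniform))
      (pick P \<phi> -` X \<inter> space (poisson_space (P \<Otimes>\<^sub>M unit_uniform)))"
  proof (rule \<Omega>.finite_measure_mono)
    have "fst x \<in> X" if "x \<in> below P ?in k" for x k
      using that by (auto simp: below_def indicator_def split: split_of_bool_asm split_of_bool)
    then have "pick P \<phi> \<omega> \<in> X" if "first_hit (below P \<phi>) \<omega> i" "point \<omega> i \<in> below P ?in (fst i)" for \<omega> i
      using that pick_eq by metis
    then show "?Win \<subseteq> pick P \<phi> -` X \<inter> space (poisson_space (P \<Otimes>\<^sub>M unit_uniform))"
      by blast
  qed simp
  finally show "measure (density P \<phi>) X \<le> measure (distr (poisson_space (P \<Otimes>\<^sub>M unit_uniform)) P (pick P \<phi>)) X"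
    by (simp add: sum1 measure_density_eq[OF int nonneg X] measure_distr)
qed simp

text \<open>If the earliest point below the maximum lies below the minimum, it lies below both
  functions and is earliest for both. An event \<open>G\<close> is returned because the set of
  agreement itself need not be measurable.\<close>

lemma pick_agree:
  assumes f: "integrable P f" "\<And>h. 0 \<le> f h" and g: "integrable P g" "\<And>h. 0 \<le> g h"
  obtains G where "G \<in> sets (poisson_space (P \<Otimes>\<^sub>M unit_uniform))"
    and "\<And>\<omega>. \<omega> \<in> G \<Longrightarrow> pick P f \<omega> = pick P g \<omega>"
    and "(\<integral>h. min (f h) (g h) \<partial>P) / (\<integral>h. max (f h) (g h) \<partial>P) \<le> measure (poisson_space (P \<Otimes>\<^sub>M unit_uniform)) G"
proof
  let ?mn = "\<lambda>h. min (f h) (g h)" and ?mx = "\<lambda>h. max (f h) (g h)"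
  have [measurable]: "f \<in> borel_measurable P" "g \<in> borel_measurable P"
    using f g by auto
  define B where "B = below P ?mn"
  define C where "C k = below P ?mx k - below P ?mn k" for k
  let ?G = "{\<omega> \<in> space (poisson_space (P \<Otimes>\<^sub>M unit_uniform)).
      \<exists>i. first_hit (\<lambda>k. B k \<union> C k) \<omega> i \<and> point \<omega> i \<in> B (fst i)}"
  have [measurable]: "B k \<in> sets (P \<Otimes>\<^sub>M unit_uniform)" "C k \<in> sets (P \<Otimes>\<^sub>M unit_uniform)" for k
    unfolding B_def C_def by auto
  have sub: "below P ?mn k \<subseteq> below P ?mx k" for k
    by (auto simp: below_def)
  then have un: "B k \<union> C k = below P ?mx k" for k
    by (auto simp: B_def C_def)
  show "?G \<in> sets (poisson_space (P \<Otimes>\<^sub>M unit_uniform))"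
    by (rule sets_first_hit_in[OF Q]) auto
  show "pick P f \<omega> = pick P g \<omega>" if "\<omega> \<in> ?G" for \<omega>
  proof -
    from that obtain i where i: "first_hit (below P ?mx) \<omega> i" "point \<omega> i \<in> below P ?mn (fst i)"
      unfolding un unfolding B_def by blast
    have "point \<omega> i \<in> below P f (fst i)" "point \<omega> i \<in> below P g (fst i)"
      using i(2) by (auto simp: below_def)
    moreover have "below P f k \<subseteq> below P ?mx k" "below P g k \<subseteq> below P ?mx k" for k
      by (auto simp: below_def)
    ultimately have "first_hit (below P f) \<omega> i" "first_hit (below P g) \<omega> i"
      by (auto intro!: first_hit_subset[OF i(1)])
    then show ?thesis by (simp add: pick_eq)
  qed
  have mn: "(\<lambda>k. measure (P \<Otimes>\<^sub>M unit_uniform) (B k)) sums (\<integral>h. ?mn h \<partial>P)"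
    unfolding B_def using f g by (intro measure_below_sums) auto
  have "(\<lambda>k. measure (P \<Otimes>\<^sub>M unit_uniform) (below P ?mx k)) sums (\<integral>h. ?mx h \<partial>P)"
    using f g by (intro measure_below_sums) (auto simp: le_max_iff_disj)
  from sums_diff[OF this mn] have "(\<lambda>k. measure (P \<Otimes>\<^sub>M unit_uniform) (C k)) sums
      ((\<integral>h. ?mx h \<partial>P) - (\<integral>h. ?mn h \<partial>P))"
    unfolding C_def B_def using sub by (subst PU.finite_measure_Diff) auto
  then have "(\<integral>h. ?mn h \<partial>P) / ((\<integral>h. ?mn h \<partial>P) + ((\<integral>h. ?mx h \<partial>P) - (\<integral>h. ?mn h \<partial>P))) \<le>
      measure (poisson_space (P \<Otimes>\<^sub>M unit_uniform)) ?G"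
    by (intro measure_first_hit_in_ge[OF Q _ _ _ mn]) (simp_all add: C_def B_def)
  then show "(\<integral>h. ?mn h \<partial>P) / (\<integral>h. ?mx h \<partial>P) \<le> measure (poisson_space (P \<Otimes>\<^sub>M unit_uniform)) ?G"
    by simp
qed

end

subsection \<open>Replicability\<close>

text \<open>Internal randomness has to live on the fixed seed type. Entry \<open>(c, 0)\<close>
  stores the number of points of cell \<open>c\<close>, entry \<open>(c, Suc j)\<close> its mark
  \<open>j\<close>; the measure is later transported along this coding.\<close>

lemma ex_inj_seed:
  "\<exists>e :: ('h \<times> real) configuration \<Rightarrow> nat \<Rightarrow> 'h \<times> real \<times> real. inj e"
proof
  let ?e = "\<lambda>(\<omega> :: ('h \<times> real) configuration) n.
    case from_nat n of
      (c, 0) \<Rightarrow> (undefined, real (fst (\<omega> c)), 0)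
    | (c, Suc j) \<Rightarrow> (fst (fst (snd (\<omega> c) j)), snd (fst (snd (\<omega> c) j)), snd (snd (\<omega> c) j))"
  show "inj ?e"
  proof (rule injI, rule ext)
    fix \<omega> \<omega>' :: "('h \<times> real) configuration" and c
    assume eq: "?e \<omega> = ?e \<omega>'"
    have "snd (\<omega> c) j = snd (\<omega>' c) j" for j
      using fun_cong[OF eq, of "to_nat (c, Suc j)"] by (simp add: prod_eq_iff)
    moreover have "fst (\<omega> c) = fst (\<omega>' c)"
      using fun_cong[OF eq, of "to_nat (c, 0 :: nat)"] by simp
    ultimately show "\<omega> c = \<omega>' c"
      by (simp add: prod_eq_iff fun_eq_iff)
  qed
qed

section \<open>Upper expectations and Jensen's inequality\<close>

text \<open>Nonnegativity of \<open>f\<close> bounds the admissible integrals from below, so that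
  their real infimum is a genuine lower bound.\<close>

lemma upper_expectation_le:
  assumes "integrable M g" "\<And>x. x \<in> space M \<Longrightarrow> f x \<le> g x" "\<And>x. x \<in> space M \<Longrightarrow> 0 \<le> f x"
  shows "upper_expectation M f \<le> integral\<^sup>L M g"
  unfolding upper_expectation_def
proof (rule cInf_lower)
  show "bdd_below {integral\<^sup>L M g | g. integrable M g \<and> (\<forall>x\<in>space M. f x \<le> g x)}"
    using assms(3) by (intro bdd_belowI[of _ 0]) (force intro!: Bochner_Integration.integral_nonneg intro: order_trans)
qed (use assms in auto)

lemma upper_expectation_nonneg:
  assumes "integrable M g" "\<And>x. x \<in> space M \<Longrightarrow> f x \<le> g x" "\<And>x. x \<in> space M \<Longrightarrow> 0 \<le> f x"
  shows "0 \<le> upper_expectation M f"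
  unfolding upper_expectation_def
  using assms by (intro cInf_greatest) (force intro!: Bochner_Integration.integral_nonneg intro: order_trans)+

lemma upper_prob_nonneg:
  assumes "prob_space M"
  shows "0 \<le> upper_prob M Q"
proof -
  interpret prob_space M by fact
  show ?thesis
    unfolding upper_prob_def by (rule upper_expectation_nonneg[where g = "\<lambda>_. 1"]) auto
qed

lemma upper_prob_le:
  assumes "prob_space M" and G: "G \<in> sets M" "\<And>x. x \<in> G \<Longrightarrow> \<not> Q x"
  shows "upper_prob M Q \<le> 1 - measure M G"
proof -
  interpret prob_space M by fact
  have "upper_prob M Q \<le> (\<integral>x. 1 - indicator G x \<partial>M)"
    unfolding upper_prob_def using G
    by (intro upper_expectation_le) (auto simp: emeasure_eq_measure split: split_indicator)
  also have "\<dots> = 1 - measure M G"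
    using G(1) by (subst Bochner_Integration.integral_diff) (auto simp: emeasure_eq_measure prob_space)
  finally show ?thesis .
qed

text \<open>The right side is the tangent at \<rho> of the concave function
  \<open>2 * t / (1 + t)\<close>; the gap is a square divided by a positive number.\<close>

lemma tangent_bound:
  fixes t \<rho> :: real
  assumes "0 \<le> t" "0 \<le> \<rho>"
  shows "2 * t / (1 + t) \<le> 2 * \<rho> / (1 + \<rho>) + 2 / (1 + \<rho>)\<^sup>2 * (t - \<rho>)"
proof -
  have "2 * \<rho> / (1 + \<rho>) + 2 / (1 + \<rho>)\<^sup>2 * (t - \<rho>) - 2 * t / (1 + t) = 2 * (t - \<rho>)\<^sup>2 / ((1 + \<rho>)\<^sup>2 * (1 + t))"
    using assms by (simp add: divide_simps add_nonneg_eq_0_iff) (simp add: algebra_simps power2_eq_square)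
  also have "\<dots> \<ge> 0"
    using assms by simp
  finally show ?thesis by simp
qed

text \<open>Neither \<open>d\<close> nor \<open>e\<close> need be measurable, so concavity acts
  through an integrable majorant \<open>g\<close> of \<open>d\<close>: the tangent at \<rho> is
  affine and increasing, and turns \<open>g\<close> into a majorant of \<open>e\<close> with known
  integral.\<close>

lemma upper_expectation_jensen:
  assumes "prob_space M"
    and d: "\<And>x. x \<in> space M \<Longrightarrow> 0 \<le> d x" "\<And>x. x \<in> space M \<Longrightarrow> d x \<le> 1"
    and e: "\<And>x. x \<in> space M \<Longrightarrow> 0 \<le> e x" "\<And>x. x \<in> space M \<Longrightarrow> e x \<le> 2 * d x / (1 + d x)"
    and le: "upper_expectation M d \<le> \<rho>"
  shows "upper_expectation M e \<le> 2 * \<rho> / (1 + \<rho>)"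
proof -
  interpret prob_space M by fact
  define c where "c = 2 / (1 + \<rho>)\<^sup>2"
  \<comment> \<open>The sign of \<rho>, needed for the tangent bound, follows from the bound on
    \<open>d\<close>.\<close>
  have "0 \<le> upper_expectation M d"
    using d by (intro upper_expectation_nonneg[where g = "\<lambda>_. 1"]) auto
  then have \<rho>: "0 \<le> \<rho>" using le by simp
  then have c: "0 < c" by (simp add: c_def)
  show ?thesis
  proof (rule field_le_epsilon)
    fix \<epsilon> :: real assume \<epsilon>: "0 < \<epsilon>"
    have "upper_expectation M d < \<rho> + \<epsilon> / c"
      using le \<epsilon> c by (intro le_less_trans[OF le]) simp
    moreover have "\<exists>y. y \<in> {integral\<^sup>L M g | g. integrable M g \<and> (\<forall>x\<in>space M. d x \<le> g x)}"
      using d(2) by (intro exI CollectI exI[of _ "\<lambda>_. 1"] conjI refl) auto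
    ultimately obtain g where g: "integrable M g" "\<And>x. x \<in> space M \<Longrightarrow> d x \<le> g x"
        "integral\<^sup>L M g < \<rho> + \<epsilon> / c"
      unfolding upper_expectation_def by (elim cInf_lessD[rotated, THEN bexE]) auto
    have "upper_expectation M e \<le> (\<integral>x. 2 * \<rho> / (1 + \<rho>) + c * (g x - \<rho>) \<partial>M)"
    proof (rule upper_expectation_le)
      fix x assume x: "x \<in> space M"
      have "e x \<le> 2 * \<rho> / (1 + \<rho>) + c * (d x - \<rho>)"
        using e(2)[OF x] tangent_bound[OF d(1)[OF x] \<rho>] by (simp add: c_def)
      also have "\<dots> \<le> 2 * \<rho> / (1 + \<rho>) + c * (g x - \<rho>)"
        using g(2)[OF x] c by simp
      finally show "e x \<le> 2 * \<rho> / (1 + \<rho>) + c * (g x - \<rho>)" .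
    qed (use g e in auto)
    also have "\<dots> = 2 * \<rho> / (1 + \<rho>) + c * (integral\<^sup>L M g - \<rho>)"
      using g(1) by (simp add: prob_space)
    also have "\<dots> \<le> 2 * \<rho> / (1 + \<rho>) + \<epsilon>"
      using g(3) c by (simp add: field_simps)
    finally show "upper_expectation M e \<le> 2 * \<rho> / (1 + \<rho>) + \<epsilon>" .
  qed
qed

section \<open>Total variation distance and densities\<close>

lemma tv_dist_bounds:
  assumes "prob_space M" "prob_space N"
  shows "0 \<le> tv_dist M N" "tv_dist M N \<le> 1"
    and "E \<in> sets M \<Longrightarrow> measure M E - measure N E \<le> tv_dist M N"
proof -
  interpret M: prob_space M by fact
  interpret N: prob_space N by fact
  have bound: "\<bar>measure M E - measure N E\<bar> \<le> 1" for E
    using M.prob_le_1[of E] N.prob_le_1[of E] measure_nonneg[of M E] measure_nonneg[of N E] by linarith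
  then have bdd: "bdd_above ((\<lambda>E. \<bar>measure M E - measure N E\<bar>) ` sets M)"
    by (intro bdd_aboveI[of _ 1]) auto
  have upper: "\<bar>measure M E - measure N E\<bar> \<le> tv_dist M N" if "E \<in> sets M" for E
    unfolding tv_dist_def using that bdd by (rule cSUP_upper)
  show "0 \<le> tv_dist M N"
    using upper[of "{}"] by simp
  show "tv_dist M N \<le> 1"
    unfolding tv_dist_def using bound by (intro cSUP_least) auto
  show "E \<in> sets M \<Longrightarrow> measure M E - measure N E \<le> tv_dist M N"
    using upper[of E] by linarith
qed

text \<open>The mass \<delta> by which \<open>f\<close> exceeds \<open>g\<close> on \<open>E\<close>
  satisfies \<open>\<integral>max = 1 + \<delta>\<close> and
  \<open>\<integral>min = 1 - \<delta>\<close>. As \<open>E\<close> competes in the supremum,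
  \<open>\<delta> \<le> d\<close>, and \<open>2 * x / (1 + x)\<close> is increasing.\<close>

lemma min_max_tv_dist:
  assumes P: "prob_space P"
    and f: "integrable P f" "\<And>h. 0 \<le> f h" "(\<integral>h. f h \<partial>P) = 1"
    and g: "integrable P g" "\<And>h. 0 \<le> g h" "(\<integral>h. g h \<partial>P) = 1"
    and prob: "prob_space (density P f)" "prob_space (density P g)"
  shows "1 - (\<integral>h. min (f h) (g h) \<partial>P) / (\<integral>h. max (f h) (g h) \<partial>P) \<le>
    2 * tv_dist (density P f) (density P g) / (1 + tv_dist (density P f) (density P g))"
proof -
  interpret P: prob_space P by fact
  have [measurable]: "f \<in> borel_measurable P" "g \<in> borel_measurable P"
    using f g by auto
  define E where "E = {h \<in> space P. g h < f h}"
  have E [measurable]: "E \<in> sets P"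
    unfolding E_def by measurable
  define \<delta> where "\<delta> = measure (density P f) E - measure (density P g) E"
  define d where "d = tv_dist (density P f) (density P g)"
  have \<delta>d: "\<delta> \<le> d"
    unfolding \<delta>_def d_def using E by (intro tv_dist_bounds(3)[OF prob]) simp
  have intE: "integrable P (\<lambda>h. indicator E h * f h)" "integrable P (\<lambda>h. indicator E h * g h)"
    using integrable_mult_indicator[OF E f(1)] integrable_mult_indicator[OF E g(1)] by auto
  have \<delta>: "\<delta> = (\<integral>h. indicator E h * f h - indicator E h * g h \<partial>P)"
    unfolding \<delta>_def using intE
    by (simp add: measure_density_eq[OF P f(1,2) E] measure_density_eq[OF P g(1,2) E])
  have "0 \<le> \<delta>"
    unfolding \<delta> by (rule Bochner_Integration.integral_nonneg) (auto simp: indicator_def E_def)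
  have "(\<integral>h. max (f h) (g h) \<partial>P) = (\<integral>h. g h + (indicator E h * f h - indicator E h * g h) \<partial>P)"
    by (rule Bochner_Integration.integral_cong) (auto simp: E_def indicator_def max_def)
  also have "\<dots> = 1 + \<delta>"
    unfolding \<delta> g(3)[symmetric] using g(1) intE
    by (intro Bochner_Integration.integral_add Bochner_Integration.integrable_diff)
  finally have mx: "(\<integral>h. max (f h) (g h) \<partial>P) = 1 + \<delta>" .
  have "(\<integral>h. min (f h) (g h) \<partial>P) = (\<integral>h. f h - (indicator E h * f h - indicator E h * g h) \<partial>P)"
    by (rule Bochner_Integration.integral_cong) (auto simp: E_def indicator_def min_def)
  also have "\<dots> = 1 - \<delta>"
    unfolding \<delta> f(3)[symmetric] using f(1) intE
    by (intro Bochner_Integration.integral_diff Bochner_Integration.integrable_diff)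
  finally have mn: "(\<integral>h. min (f h) (g h) \<partial>P) = 1 - \<delta>" .
  have "1 - (1 - \<delta>) / (1 + \<delta>) = 2 * \<delta> / (1 + \<delta>)"
    using \<open>0 \<le> \<delta>\<close> by (simp add: field_simps)
  also have "\<dots> \<le> 2 * d / (1 + d)"
    using \<open>0 \<le> \<delta>\<close> \<delta>d by (simp add: field_simps)
  finally show ?thesis
    by (simp add: mx mn d_def)
qed

text \<open>The Radon-Nikodym derivative is replaced by a real function that is nonnegative
  everywhere, as \<open>measure_below_sums\<close> requires.\<close>

lemma ex_real_density:
  assumes "prob_space P" "prob_space N" "absolutely_continuous P N" "sets N = sets P"
  shows "\<exists>f. integrable P f \<and> (\<forall>h. 0 \<le> f h) \<and> (\<integral>h. f h \<partial>P) = (1 :: real) \<and> density P f = N"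
proof -
  interpret P: prob_space P by fact
  interpret N: prob_space N by fact
  obtain f where f [measurable]: "f \<in> borel_measurable P" and eq: "AE h in P. RN_deriv P N h = ennreal (f h)"
    and nonneg: "\<And>h. 0 \<le> f h"
    using P.real_RN_deriv[of N] assms N.finite_measure_axioms by metis
  have "density P f = density P (RN_deriv P N)"
    using eq by (intro density_cong) auto
  also have "\<dots> = N"
    using assms by (intro P.density_RN_deriv)
  finally have dens: "density P f = N" .
  have "(\<integral>\<^sup>+h. ennreal (f h) \<partial>P) = emeasure (density P f) (space P)"
    by (simp add: emeasure_density cong: nn_integral_cong)
  also have "\<dots> = ennreal 1"
    using N.emeasure_space_1 sets_eq_imp_space_eq[OF assms(4)] by (simp add: dens)
  finally have "integrable P f \<and> (\<integral>h. f h \<partial>P) = 1"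
    using nonneg by (subst (asm) nn_integral_eq_integrable) auto
  with nonneg dens show ?thesis by blast
qed

text \<open>A sample \<open>S\<close> has positive outer probability under the law of \<open>S\<close> evaluated at a random index,
  so almost sure properties for every distribution hold surely.\<close>

lemma AE_all_distributions_imp:
  assumes "space MX = UNIV" and S: "S \<in> space (sample_space MX n)"
    and AE: "\<And>D. D \<in> distributions MX \<Longrightarrow> AE S in iid_samples n D. K S"
  shows "K S"
proof (rule ccontr)
  assume "\<not> K S"
  let ?p = "measure_pmf (poisson_pmf 1)"
  let ?D = "distr ?p (example_space MX) S"
  let ?X = "\<Pi>\<^sub>E i\<in>{..<n}. {i}"
  interpret pn: finite_product_prob_space "\<lambda>_. ?p" "{..<n}" by standard auto
  have UNIV: "space (example_space MX) = UNIV"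
    using assms(1) by (simp add: example_space_def space_pair_measure)
  \<comment> \<open>At indices from \<open>n\<close> on, \<open>S\<close> is
    \<open>undefined\<close>, which is still an example because the domain fills its type.\<close>
  have meas: "S \<in> ?p \<rightarrow>\<^sub>M example_space MX"
    by (simp add: UNIV)
  have "?D \<in> distributions MX"
    unfolding distributions_def using measure_pmf.prob_space_distr[OF meas] by simp
  then have "AE x in (\<Pi>\<^sub>M i\<in>{..<n}. ?D). K x"
    using AE unfolding iid_samples_def by blast
  also have "(\<Pi>\<^sub>M i\<in>{..<n}. ?D) = (\<Pi>\<^sub>M i\<in>{..<n}. distr ?p ?D S)"
    by (intro PiM_cong refl distr_cong) simp
  also have "\<dots> = distr (\<Pi>\<^sub>M i\<in>{..<n}. ?p) (\<Pi>\<^sub>M i\<in>{..<n}. ?D) (compose {..<n} S)"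
    using meas by (intro distr_PiM_finite_prob_space'[symmetric])
      (auto simp: prob_space_measure_pmf intro!: measure_pmf.prob_space_distr)
  finally have AE_distr: "AE x in distr (\<Pi>\<^sub>M i\<in>{..<n}. ?p) (\<Pi>\<^sub>M i\<in>{..<n}. ?D) (compose {..<n} S). K x" .
  have "compose {..<n} S \<in> (\<Pi>\<^sub>M i\<in>{..<n}. ?p) \<rightarrow>\<^sub>M (\<Pi>\<^sub>M i\<in>{..<n}. ?D)"
    unfolding compose_def using meas
    by (intro measurable_restrict measurable_compose[OF measurable_component_singleton]) auto
  from AE_distrD[OF this AE_distr] have "AE x in (\<Pi>\<^sub>M i\<in>{..<n}. ?p). K (compose {..<n} S x)" .
  moreover have "compose {..<n} S x = S" if "x \<in> ?X" for x
  proof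
    fix i show "compose {..<n} S x i = S i"
      using that S PiE_mem[OF that, of i] PiE_arb[of S "{..<n}" _ i]
      by (cases "i < n") (auto simp: compose_def sample_space_def space_PiM)
  qed
  \<comment> \<open>\<open>K\<close> need not be measurable; the contradiction comes from the box
    \<open>?X\<close> alone, which is measurable and has positive probability.\<close>
  ultimately have "AE x in (\<Pi>\<^sub>M i\<in>{..<n}. ?p). x \<notin> ?X"
    using \<open>\<not> K S\<close> by (auto elim: eventually_mono)
  moreover have "?X \<in> sets (\<Pi>\<^sub>M i\<in>{..<n}. ?p)"
    by (intro sets_PiM_I_finite) auto
  ultimately have "measure (\<Pi>\<^sub>M i\<in>{..<n}. ?p) ?X = 0"
    using AE_iff_null_sets by (metis measure_eq_0_null_sets)
  moreover have "measure (\<Pi>\<^sub>M i\<in>{..<n}. ?p) ?X = (\<Prod>i<n. pmf (poisson_pmf 1) i)"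
    by (subst pn.finite_measure_PiM_emb) (auto simp: measure_pmf_single)
  ultimately show False by simp
qed

section \<open>The coupled implementation of the rule\<close>

theorem theorem2:
  fixes MX :: "'x measure"
    and H P :: "('x \<Rightarrow> bool) measure"
    and n :: nat and \<rho> :: real
    and A :: "(nat \<Rightarrow> 'x \<times> bool) \<Rightarrow> ('x \<Rightarrow> bool) measure"
  assumes "space MX = UNIV"
    and "space H = UNIV"
    and "prob_space P" and "sets P = sets H"
    and "learning_rule MX H n A"
    and "tv_indistinguishable MX n \<rho> A"
    and "absolutely_continuous_rule MX n P A"
  shows "\<exists>A'. learning_rule MX H n A' \<and> equivalent_rules MX n A A' \<and>
    replicable MX H n (2 * \<rho> / (1 + \<rho>)) A'"
proof (intro exI[of _ A] conjI)
  \<comment> \<open>A rule is represented by its output laws, so \<open>A\<close> serves as its own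
    equivalent rule; only the implementation is new.\<close>
  show "learning_rule MX H n A" by fact
  show "equivalent_rules MX n A A" by (simp add: equivalent_rules_def)
  note P = \<open>prob_space P\<close>
  let ?\<Omega> = "poisson_space (P \<Otimes>\<^sub>M unit_uniform)"
  interpret \<Omega>: prob_space ?\<Omega>
    by (intro prob_space_poisson_space prob_space_marked P)
  have A: "prob_space (A S)" "sets (A S) = sets P" if "S \<in> space (sample_space MX n)" for S
    using assms(4,5) that unfolding learning_rule_def by auto
  \<comment> \<open>\<open>implements\<close> prescribes the law for every sample, so a density is
    needed surely and not only almost surely.\<close>
  have ac: "absolutely_continuous P (A S)" if "S \<in> space (sample_space MX n)" for S
    by (rule AE_all_distributions_imp[OF assms(1) that, where K = "\<lambda>S. absolutely_continuous P (A S)"])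
       (use assms(7) in \<open>simp add: absolutely_continuous_rule_def\<close>)
  have "\<forall>S\<in>space (sample_space MX n). \<exists>f. integrable P f \<and> (\<forall>h. 0 \<le> f h) \<and>
      (\<integral>h. f h \<partial>P) = (1 :: real) \<and> density P f = A S"
  proof
    fix S assume S: "S \<in> space (sample_space MX n)"
    show "\<exists>f. integrable P f \<and> (\<forall>h. 0 \<le> f h) \<and> (\<integral>h. f h \<partial>P) = (1 :: real) \<and> density P f = A S"
      by (rule ex_real_density[OF P A(1)[OF S] ac[OF S] A(2)[OF S]])
  qed
  then obtain f :: "_ \<Rightarrow> _ \<Rightarrow> real" where "\<forall>S\<in>space (sample_space MX n).
      integrable P (f S) \<and> (\<forall>h. 0 \<le> f S h) \<and> (\<integral>h. f S h \<partial>P) = 1 \<and> density P (f S) = A S"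
    by (rule bchoice[THEN exE])
  then have f: "integrable P (f S)" "\<And>h. 0 \<le> f S h" "(\<integral>h. f S h \<partial>P) = 1" "density P (f S) = A S"
    if "S \<in> space (sample_space MX n)" for S
    using that by auto
  obtain e :: "(('x \<Rightarrow> bool) \<times> real) configuration \<Rightarrow> 'x seed" where e: "inj e"
    using ex_inj_seed by blast
  \<comment> \<open>The measurable sets of \<open>R\<close> are the images under \<open>e\<close> of
    measurable sets, so the agreement event \<open>G\<close> can be carried over.\<close>
  define R where "R = embed_measure ?\<Omega> e"
  have e_meas: "e \<in> ?\<Omega> \<rightarrow>\<^sub>M R"
    unfolding R_def by (rule measurable_embed_measure2[OF e])
  have R: "R = distr ?\<Omega> R e"
    unfolding R_def by (rule embed_measure_eq_distr[OF e])
  have "prob_space R"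
    by (subst R) (rule \<Omega>.prob_space_distr[OF e_meas])
  \<comment> \<open>\<open>inv e\<close> is arbitrary off the range of \<open>e\<close>, but the
    space of \<open>R\<close> lies inside that range.\<close>
  define F where "F S r = pick P (f S) (inv e r)" for S r
  have Fe: "F S (e \<omega>) = pick P (f S) \<omega>" for S \<omega>
    by (simp add: F_def inv_f_f[OF e])
  have F_meas: "F S \<in> R \<rightarrow>\<^sub>M P" if "S \<in> space (sample_space MX n)" for S
    unfolding R_def using measurable_pick[OF P, of "f S"] f(1)[OF that]
    by (intro measurable_embed_measure1) (simp add: Fe)
  have "distr R P (F S) = A S" if "S \<in> space (sample_space MX n)" for S
  proof -
    have "distr R P (F S) = distr ?\<Omega> P (pick P (f S))"
      by (subst R, subst distr_distr[OF F_meas[OF that] e_meas]) (simp add: comp_def Fe)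
    then show ?thesis
      using distr_pick[OF P f(1-3)[OF that]] f(4)[OF that] by simp
  qed
  then have "distr R H (F S) = A S" if "S \<in> space (sample_space MX n)" for S
    using that distr_cong[of R R H P "F S" "F S"] assms(4) by simp
  moreover have "F S \<in> R \<rightarrow>\<^sub>M H" if "S \<in> space (sample_space MX n)" for S
    using F_meas[OF that] measurable_cong_sets[of R R P H] assms(4) by simp
  ultimately have implements: "implements MX H n R F A"
    unfolding implements_def by (intro ballI conjI)
  have mismatch: "upper_prob R (\<lambda>r. F S r \<noteq> F S' r) \<le> 2 * tv_dist (A S) (A S') / (1 + tv_dist (A S) (A S'))"
    if S: "S \<in> space (sample_space MX n)" and S': "S' \<in> space (sample_space MX n)" for S S'
  proof -
    obtain G where G: "G \<in> sets ?\<Omega>" "\<And>\<omega>. \<omega> \<in> G \<Longrightarrow> pick P (f S) \<omega> = pick P (f S') \<omega>"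
      "(\<integral>h. min (f S h) (f S' h) \<partial>P) / (\<integral>h. max (f S h) (f S' h) \<partial>P) \<le> measure ?\<Omega> G"
      by (rule pick_agree[OF P f(1,2)[OF S] f(1,2)[OF S']]) blast
    have "upper_prob R (\<lambda>r. F S r \<noteq> F S' r) \<le> 1 - measure R (e ` G)"
      using G(1,2) unfolding R_def
      by (intro upper_prob_le \<open>prob_space R\<close>[unfolded R_def] in_sets_embed_measure) (auto simp: Fe)
    also have "measure R (e ` G) = measure ?\<Omega> G"
      unfolding R_def measure_def
      using e G(1) by (subst emeasure_embed_measure_image) (auto intro: inj_on_subset)
    also have "1 - \<dots> \<le> 1 - (\<integral>h. min (f S h) (f S' h) \<partial>P) / (\<integral>h. max (f S h) (f S' h) \<partial>P)"
      using G(3) by simp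
    also have "\<dots> \<le> 2 * tv_dist (A S) (A S') / (1 + tv_dist (A S) (A S'))"
      using min_max_tv_dist[OF P f(1-3)[OF S] f(1-3)[OF S']] A(1) f(4) S S' by simp
    finally show ?thesis .
  qed
  have "upper_expectation (iid_samples n D \<Otimes>\<^sub>M iid_samples n D)
      (\<lambda>(S, S'). upper_prob R (\<lambda>r. F S r \<noteq> F S' r)) \<le> 2 * \<rho> / (1 + \<rho>)"
    if D: "D \<in> distributions MX" for D
  proof -
    have "prob_space D" and sets_D: "sets D = sets (example_space MX)"
      using D by (auto simp: distributions_def)
    then interpret I: prob_space "iid_samples n D"
      unfolding iid_samples_def by (intro prob_space_PiM)
    interpret II: pair_prob_space "iid_samples n D" "iid_samples n D" ..
    have "sets (iid_samples n D) = sets (sample_space MX n)"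
      unfolding iid_samples_def sample_space_def using sets_D by (intro sets_PiM_cong) auto
    then have space: "space (iid_samples n D) = space (sample_space MX n)"
      by (rule sets_eq_imp_space_eq)
    show ?thesis
    proof (rule upper_expectation_jensen)
      show "prob_space (iid_samples n D \<Otimes>\<^sub>M iid_samples n D)"
        by unfold_locales
      show "upper_expectation (iid_samples n D \<Otimes>\<^sub>M iid_samples n D) (\<lambda>(S, S'). tv_dist (A S) (A S')) \<le> \<rho>"
        using assms(6) D unfolding tv_indistinguishable_def by blast
    qed (auto simp: space space_pair_measure tv_dist_bounds A mismatch upper_prob_nonneg \<open>prob_space R\<close>)
  qed
  then show "replicable MX H n (2 * \<rho> / (1 + \<rho>)) A"
    using \<open>prob_space R\<close> implements unfolding replicable_def replicable_implementation_def
    by (intro exI conjI ballI)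
qed

end
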